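(* Let $G$ be an abelian group and let $\mathcal A=(A_1,\dots,A_q)$ be a tuple of finite nonempty subsets of $G$ with $|A_i|=k_i$ for $1\le i\le q$. Then for every $r\in\mathbb N$ and every $\mathbf h\in\mathbb N_0^q$ there exists a set $X_{\mathbf h}\subseteq G$ such that $(r\mathbf h)\cdot\mathcal A\subseteq X_{\mathbf h}+\mathbf h\cdot\mathcal A$ and \[ |X_{\mathbf h}|\le\prod_{i=1}^q\binom{(r+1)(k_i-1)}{k_i-1}. \] In particular, $\mathcal A$ is a chromatic $(r,\ell)$-approximate group with $\ell=\prod_{i=1}^q\binom{(r+1)(k_i-1)}{k_i-1}$.
   Context: $\mathbb N=\{1,2,\dots\}$, $\mathbb N_0=\{0,1,2,\dots\}$. For subsets $X,Y$ of an abelian group, $X+Y=\{x+y:x\in X,y\in Y\}$; for $h\in\mathbb N$, $hA$ is the $h$-fold sumset $A+\cdots+A$ and $0A=\{0\}$. For $\mathbf h=(h_1,\dots,h_q)\in\mathbb N_0^q$, $\mathbf h\cdot\mathcal A=h_1A_1+\cdots+h_qA_q$ and $r\mathbf h=(rh_1,\dots,rh_q)$. A tuple $\mathcal A$ is a chromatic $(r,\ell)$-approximate group if for every $\mathbf h\in\mathbb N_0^q$ there is $X_{\mathbf h}\subseteq G$ with $|X_{\mathbf h}|\le\ell$ and $(r\mathbf h)\cdot\mathcal A\subseteq X_{\mathbf h}+\mathbf h\cdot\mathcal A$. *)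

theory Defs
  imports Main "HOL-Library.Set_Algebras"
begin

text \<open>
  Sumsets are the pointwise sums of \<^theory>\<open>HOL-Library.Set_Algebras\<close>, where \<open>0 = {0}\<close> as a set, so that
  finite sums \<open>\<Sum>\<close> of sets are iterated sumsets and the empty sum is \<open>{0}\<close>.
  A tuple \<open>(A\<^sub>1, \<dots>, A\<^sub>q)\<close> is a function restricted to the indices \<open>{1..q}\<close>; its values
  elsewhere are irrelevant.
\<close>

definition fold_sumset :: "nat \<Rightarrow> 'a::ab_group_add set \<Rightarrow> 'a set" where
  "fold_sumset h A = (\<Sum>j = 1..h. A)"

definition chromatic_sumset :: "nat \<Rightarrow> (nat \<Rightarrow> nat) \<Rightarrow> (nat \<Rightarrow> 'a::ab_group_add set) \<Rightarrow> 'a set" where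
  "chromatic_sumset q h A = (\<Sum>i = 1..q. fold_sumset (h i) (A i))"

text \<open>
  The conjunct \<open>finite X\<close> is needed because \<^const>\<open>card\<close> of an infinite set is \<open>0\<close>.
\<close>

definition chromatic_approximate_group ::
    "nat \<Rightarrow> (nat \<Rightarrow> 'a::ab_group_add set) \<Rightarrow> nat \<Rightarrow> nat \<Rightarrow> bool" where
  "chromatic_approximate_group q A r l \<longleftrightarrow>
    (\<forall>h :: nat \<Rightarrow> nat. \<exists>X :: 'a set.
      finite X \<and> card X \<le> l \<and>
      chromatic_sumset q (\<lambda>i. r * h i) A \<subseteq> X + chromatic_sumset q h A)"

end

theory Submission
  imports Defs "HOL-Library.Multiset"
begin

text \<open>
  An element of \<open>(r h) A\<close> is the sum of a multiset \<open>M\<close> of \<open>r h\<close> elements of \<open>A\<close>. Fix \<open>a \<in> A\<close>, let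
  \<open>d = |A| - 1\<close> and \<open>t = \<lfloor>h / d\<rfloor> + 1\<close>, and divide the multiplicity in \<open>M\<close> of every element other
  than \<open>a\<close> by \<open>t\<close>. The \<open>d\<close> remainders add up to at most \<open>d (t - 1) \<le> h\<close>, so that, filled up with copies
  of \<open>a\<close>, they form an element of \<open>h A\<close>. The quotients add up to at most \<open>r h / t \<le> r d\<close>; filled up
  with copies of \<open>a\<close>, they form one of the \<open>(r d + d) choose d\<close> multisets of size \<open>r d\<close> over \<open>A\<close>, and
  this multiset determines the translation. The general case is the sum over the colours.
\<close>

lemma fold_sumset_0: "fold_sumset 0 A = {0}"
  by (simp add: fold_sumset_def)

lemma fold_sumset_Suc: "fold_sumset (Suc n) A = A + fold_sumset n A"
  by (simp add: fold_sumset_def add.commute)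

text \<open>Addition is commutative, so only the multiplicities of the summands matter. Multisets
  instead of sequences make the later count a binomial coefficient.\<close>

lemma fold_sumset_eq_sum_mset: "fold_sumset n A = sum_mset ` multisets_of_size A n"
proof (induction n)
  case 0
  show ?case by (simp add: fold_sumset_0)
next
  case (Suc n)
  have "sum_mset ` multisets_of_size A (Suc n) = A + sum_mset ` multisets_of_size A n"
  proof (intro equalityI subsetI)
    fix x assume "x \<in> sum_mset ` multisets_of_size A (Suc n)"
    then obtain M where M: "x = sum_mset M" "set_mset M \<subseteq> A" "size M = Suc n"
      by (auto simp: multisets_of_size_def)
    then obtain a N where "M = add_mset a N"
      by (auto dest: size_eq_Suc_imp_eq_union)
    with M show "x \<in> A + sum_mset ` multisets_of_size A n"
      by (auto simp: multisets_of_size_def intro!: set_plus_intro)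
  next
    fix x assume "x \<in> A + sum_mset ` multisets_of_size A n"
    then obtain a N where "x = a + sum_mset N" "a \<in> A" "set_mset N \<subseteq> A" "size N = n"
      by (auto simp: multisets_of_size_def elim!: set_plus_elim)
    then show "x \<in> sum_mset ` multisets_of_size A (Suc n)"
      by (intro image_eqI[of _ _ "add_mset a N"]) (auto simp: multisets_of_size_def)
  qed
  with Suc show ?case by (simp add: fold_sumset_Suc)
qed

text \<open>A sumset is the image of a product under addition. Finiteness goes through the same
  induction because \<open>card_image_le\<close> needs it for the partial sum.\<close>

lemma card_sum_sets_le:
  assumes "finite I" "\<And>i. i \<in> I \<Longrightarrow> finite (X i)"
  shows "finite (\<Sum>i\<in>I. X i) \<and> card (\<Sum>i\<in>I. X i) \<le> (\<Prod>i\<in>I. card (X i))"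
  using assms
proof (induction rule: finite_induct)
  case (insert i I)
  have "card (X i + (\<Sum>i\<in>I. X i)) \<le> card (X i) * card (\<Sum>i\<in>I. X i)"
    unfolding set_plus_image
    using insert by (metis card_cartesian_product card_image_le finite_cartesian_product insertCI)
  also have "\<dots> \<le> card (X i) * (\<Prod>i\<in>I. card (X i))"
    using insert by simp
  finally show ?case
    using insert by (simp add: finite_set_plus)
qed simp

lemma sum_sets_mono:
  fixes X Y :: "'i \<Rightarrow> 'b::comm_monoid_add set"
  assumes "\<And>i. i \<in> I \<Longrightarrow> X i \<subseteq> Y i"
  shows "(\<Sum>i\<in>I. X i) \<subseteq> (\<Sum>i\<in>I. Y i)"
  using assms by (induction I rule: infinite_finite_induct) (simp_all add: set_plus_mono2)

text \<open>Either of \<open>M\<close> and \<open>repeat_mset t Q + R\<close> can have more copies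
  of \<open>a\<close>. Padding both sides avoids multiset subtraction and gives each side the size
  \<open>r * h + t * (r * d) + h\<close>.\<close>

lemma multiset_division_with_remainder:
  assumes "finite A" "a \<in> A" "M \<in> multisets_of_size A (r * h)"
    and d: "d = card A - 1" and t: "t = h div d + 1"
  obtains Q R where "Q \<in> multisets_of_size A (r * d)" "R \<in> multisets_of_size A h"
    "M + replicate_mset (t * (r * d) + h) a = repeat_mset t Q + R + replicate_mset (r * h) a"
proof -
  define B where "B = A - {a}"
  define C where "C = (\<Sum>b\<in>B. replicate_mset (count M b div t) b)"
  define D where "D = (\<Sum>b\<in>B. replicate_mset (count M b mod t) b)"
  have B: "finite B" "card B = d" "a \<notin> B"
    using assms by (auto simp: B_def)
  have M: "set_mset M \<subseteq> A" "size M = r * h"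
    using assms(3) by (auto simp: multisets_of_size_def)
  have count_C: "count C x = (if x \<in> B then count M x div t else 0)" for x
    using B(1) by (simp add: C_def count_sum)
  have count_D: "count D x = (if x \<in> B then count M x mod t else 0)" for x
    using B(1) by (simp add: D_def count_sum)
  have set_C: "set_mset C \<subseteq> B" and set_D: "set_mset D \<subseteq> B"
    using count_C count_D by (auto simp: count_eq_zero_iff simp flip: count_greater_zero_iff split: if_splits)
  have size_B: "size N = (\<Sum>b\<in>B. count N b)" if "set_mset N \<subseteq> B" for N
    using that B(1) unfolding size_multiset_overloaded_eq
    by (intro sum.mono_neutral_left) (auto simp: not_in_iff)
  have "(\<Sum>b\<in>B. count M b) = size (filter_mset (\<lambda>b. b \<noteq> a) M)"
    using M(1) by (subst size_B) (auto simp: B_def)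
  also have "\<dots> \<le> r * h"
    using size_filter_mset_lesseq[of _ M] M(2) by simp
  finally have sum_le: "(\<Sum>b\<in>B. count M b) \<le> r * h" .
  have "size C \<le> r * d"
  \<comment> \<open>For \<open>d = 0\<close> division by zero gives \<open>t = 1\<close>, and
    \<open>h \<le> t * d\<close> fails for positive \<open>h\<close>; but then \<open>a\<close> is
    the only element of \<open>A\<close>.\<close>
  proof (cases "d = 0")
    case True
    then have "B = {}" using B by simp
    then show ?thesis by (simp add: C_def)
  next
    case False
    have "t * size C \<le> (\<Sum>b\<in>B. count M b)"
      by (subst size_B[OF set_C]) (auto simp: count_C sum_distrib_left intro!: sum_mono)
    also have "\<dots> \<le> r * (t * d)"
    proof -
      \<comment> \<open>This is why \<open>t\<close> exceeds \<open>h div d\<close>: rounding up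
        bounds the quotients.\<close>
      have "h \<le> t * d"
        unfolding t using False
        by (metis Suc_eq_plus1 dividend_less_div_times less_imp_le mult_Suc neq0_conv)
      then show ?thesis using sum_le by (meson le_trans mult_le_mono2)
    qed
    also have "\<dots> = t * (r * d)"
      by (rule mult.left_commute)
    finally show ?thesis
      by (simp only: mult_le_cancel1) (simp add: t)
  qed
  moreover have "size D \<le> h"
  proof -
    \<comment> \<open>Each of the \<open>d\<close> remainders is at most
      \<open>t - 1 = h div d\<close>.\<close>
    have "size D \<le> (\<Sum>b\<in>B. h div d)"
      unfolding size_B[OF set_D]
    proof (intro sum_mono)
      fix b assume "b \<in> B"
      have "count M b mod t < t" using t by simp
      then show "count D b \<le> h div d" using t by (simp add: count_D)
    qed
    also have "\<dots> \<le> h" using B by simp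
    finally show ?thesis .
  qed
  ultimately have sizes: "size C \<le> r * d" "size D \<le> h" by blast+
  \<comment> \<open>By \<open>sizes\<close> the subtractions do not truncate, so \<open>Q\<close>
    and \<open>R\<close> get exactly the sizes \<open>r * d\<close> and \<open>h\<close>.\<close>
  define Q where "Q = C + replicate_mset (r * d - size C) a"
  define R where "R = D + replicate_mset (h - size D) a"
  define L where "L = M + replicate_mset (t * (r * d) + h) a"
  define L' where "L' = repeat_mset t Q + R + replicate_mset (r * h) a"
  have off: "count L x = count L' x" if "x \<noteq> a" for x
    using that M(1) by (auto simp: L_def L'_def Q_def R_def count_C count_D B_def not_in_iff)
  have size_Q: "size Q = r * d" and size_R: "size R = h"
    using sizes by (simp_all add: Q_def R_def)
  \<comment> \<open>The multiplicity of \<open>a\<close> need not be computed: multisets of equal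
    size that agree off \<open>a\<close> also agree at \<open>a\<close>.\<close>
  have "size L = size L'"
    by (simp add: L_def L'_def M size_Q size_R)
  moreover have "size N = size (filter_mset (\<lambda>x. x \<noteq> a) N) + count N a" for N
    by (induction N) auto
  moreover have "filter_mset (\<lambda>x. x \<noteq> a) L = filter_mset (\<lambda>x. x \<noteq> a) L'"
    by (rule multiset_eqI) (simp add: off)
  ultimately have "count L a = count L' a"
    by (metis add_left_cancel)
  with off have "L = L'"
    by (metis multiset_eqI)
  moreover have "Q \<in> multisets_of_size A (r * d)" "R \<in> multisets_of_size A h"
    using set_C set_D assms(2) size_Q size_R
    by (auto simp: multisets_of_size_def Q_def R_def B_def)
  ultimately show thesis
    using that by (simp add: L_def L'_def)
qed

text \<open>The quotient \<open>Q\<close> alone selects the translate, and its size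
  \<open>r * d\<close> is independent of \<open>h\<close>; hence so is the bound.\<close>

lemma fold_sumset_covering:
  fixes A :: "'a::ab_group_add set"
  assumes "finite A" "A \<noteq> {}"
  obtains X where "finite X" "card X \<le> ((r + 1) * (card A - 1)) choose (card A - 1)"
    "fold_sumset (r * h) A \<subseteq> X + fold_sumset h A"
proof -
  obtain a where a: "a \<in> A" using assms by blast
  define d where "d = card A - 1"
  define t where "t = h div d + 1"
  \<comment> \<open>The division identity, summed and solved for the sum of \<open>M\<close>, with
    the sum of \<open>R\<close> left out.\<close>
  define shift where "shift Q = sum_mset (repeat_mset t Q)
    + sum_mset (replicate_mset (r * h) a) - sum_mset (replicate_mset (t * (r * d) + h) a)" for Q
  let ?X = "shift ` multisets_of_size A (r * d)"
  have card_A: "card A = Suc d"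
    using assms card_gt_0_iff[of A] by (auto simp: d_def)
  have "card ?X \<le> card (multisets_of_size A (r * d))"
    using assms(1) by (intro card_image_le finite_multisets_of_size)
  \<comment> \<open>Stars and bars over the \<open>d + 1\<close> elements of
    \<open>A\<close>.\<close>
  also have "\<dots> = (d + r * d) choose (r * d)"
    using assms(1) by (simp add: card_multisets_of_size card_A)
  also have "\<dots> = ((r + 1) * d) choose d"
    using binomial_symmetric[of d "d + r * d"] by (simp add: algebra_simps)
  finally have card: "card ?X \<le> ((r + 1) * d) choose d" .
  have "fold_sumset (r * h) A \<subseteq> ?X + fold_sumset h A"
  proof
    fix x assume "x \<in> fold_sumset (r * h) A"
    then obtain M where M: "x = sum_mset M" "M \<in> multisets_of_size A (r * h)"
      by (auto simp: fold_sumset_eq_sum_mset)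
    obtain Q R where QR: "Q \<in> multisets_of_size A (r * d)" "R \<in> multisets_of_size A h"
      "M + replicate_mset (t * (r * d) + h) a = repeat_mset t Q + R + replicate_mset (r * h) a"
      using multiset_division_with_remainder[OF assms(1) a M(2) d_def t_def] by blast
    from arg_cong[OF QR(3), of sum_mset] have "x = shift Q + sum_mset R"
      unfolding shift_def M(1) sum_mset.union by (simp add: algebra_simps)
    then show "x \<in> ?X + fold_sumset h A"
      using QR by (auto simp: fold_sumset_eq_sum_mset)
  qed
  with card show thesis
    using assms(1) by (intro that[of ?X]) (auto simp: d_def)
qed

lemma chromatic_sumset_covering:
  fixes A :: "nat \<Rightarrow> 'a::ab_group_add set"
  assumes "\<And>i. i \<in> {1..q} \<Longrightarrow> finite (A i) \<and> A i \<noteq> {}"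
  obtains X where "finite X"
    "chromatic_sumset q (\<lambda>i. r * h i) A \<subseteq> X + chromatic_sumset q h A"
    "card X \<le> (\<Prod>i = 1..q. ((r + 1) * (card (A i) - 1)) choose (card (A i) - 1))"
proof -
  have "\<forall>i\<in>{1..q}. \<exists>X. finite X \<and> card X \<le> ((r + 1) * (card (A i) - 1)) choose (card (A i) - 1) \<and>
      fold_sumset (r * h i) (A i) \<subseteq> X + fold_sumset (h i) (A i)"
    using assms fold_sumset_covering by metis
  then obtain X where X: "\<And>i. i \<in> {1..q} \<Longrightarrow> finite (X i)"
    "\<And>i. i \<in> {1..q} \<Longrightarrow> card (X i) \<le> ((r + 1) * (card (A i) - 1)) choose (card (A i) - 1)"
    "\<And>i. i \<in> {1..q} \<Longrightarrow> fold_sumset (r * h i) (A i) \<subseteq> X i + fold_sumset (h i) (A i)"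
    by metis
  show thesis
  proof (rule that)
    show "finite (\<Sum>i = 1..q. X i)"
      using card_sum_sets_le[of "{1..q}" X] X(1) by blast
    show "chromatic_sumset q (\<lambda>i. r * h i) A \<subseteq> (\<Sum>i = 1..q. X i) + chromatic_sumset q h A"
      \<comment> \<open>Read backwards, \<open>sum.distrib\<close> merges the two sums into one, so
        that the inclusion can be checked colour by colour.\<close>
      unfolding chromatic_sumset_def sum.distrib[symmetric] by (intro sum_sets_mono X(3))
    have "card (\<Sum>i = 1..q. X i) \<le> (\<Prod>i = 1..q. card (X i))"
      using card_sum_sets_le[of "{1..q}" X] X(1) by blast
    also have "\<dots> \<le> (\<Prod>i = 1..q. ((r + 1) * (card (A i) - 1)) choose (card (A i) - 1))"
      using X(2) by (intro prod_mono) simp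
    finally show "card (\<Sum>i = 1..q. X i)
      \<le> (\<Prod>i = 1..q. ((r + 1) * (card (A i) - 1)) choose (card (A i) - 1))" .
  qed
qed

theorem theorem1p12:
  fixes A :: "nat \<Rightarrow> 'a::ab_group_add set" and k :: "nat \<Rightarrow> nat" and q :: nat
  assumes "q \<ge> 1"
    and "\<forall>i\<in>{1..q}. finite (A i) \<and> A i \<noteq> {} \<and> card (A i) = k i"
  shows "\<forall>r::nat. r \<ge> 1 \<longrightarrow>
    (\<forall>h :: nat \<Rightarrow> nat. \<exists>X :: 'a set.
      finite X \<and>
      chromatic_sumset q (\<lambda>i. r * h i) A \<subseteq> X + chromatic_sumset q h A \<and>
      card X \<le> (\<Prod>i = 1..q. ((r + 1) * (k i - 1)) choose (k i - 1))) \<and>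
    chromatic_approximate_group q A r (\<Prod>i = 1..q. ((r + 1) * (k i - 1)) choose (k i - 1))"
proof -
  have "\<exists>X. finite X \<and>
      chromatic_sumset q (\<lambda>i. r * h i) A \<subseteq> X + chromatic_sumset q h A \<and>
      card X \<le> (\<Prod>i = 1..q. ((r + 1) * (k i - 1)) choose (k i - 1))" for r h
  proof -
    have prod: "(\<Prod>i = 1..q. ((r + 1) * (card (A i) - 1)) choose (card (A i) - 1))
        = (\<Prod>i = 1..q. ((r + 1) * (k i - 1)) choose (k i - 1))"
      using assms(2) by (intro prod.cong) auto
    have "finite (A i) \<and> A i \<noteq> {}" if "i \<in> {1..q}" for i
      using assms(2) that by blast
    then obtain X where "finite X"
      "chromatic_sumset q (\<lambda>i. r * h i) A \<subseteq> X + chromatic_sumset q h A"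
      "card X \<le> (\<Prod>i = 1..q. ((r + 1) * (card (A i) - 1)) choose (card (A i) - 1))"
      by (rule chromatic_sumset_covering[where q = q and A = A and r = r and h = h])
    then show ?thesis
      unfolding prod by blast
  qed
  then show ?thesis
    unfolding chromatic_approximate_group_def by blast
qed

end
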